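(* Let $R$ be a commutative ring with unity and let $M$ be an $R$-module with $\operatorname{Spec}(M)\neq\emptyset$. Then $\widetilde{\operatorname{Spec}(M)}$ is a $T_1$-space if and only if $\{(Q:M) \mid Q\in\operatorname{Spec}(M)\}$ is a set of incomparable prime ideals.
   Context: For a submodule $N$ of an $R$-module $M$, $(N:M)=\{r\in R : rM\subseteq N\}$. A proper submodule $P$ of $M$ is prime if whenever $rm\in P$ with $r\in R$, $m\in M$, then $m\in P$ or $r\in(P:M)$; in this case $(P:M)$ is a prime ideal of $R$. $\operatorname{Spec}(M)$ is the set of all prime submodules of $M$. A set of prime ideals is a set of incomparable prime ideals if no member of the set is contained in a different member of the set. A subset $T\subseteq R$ is multiplicatively closed if $1\in T$ and $xy\in T$ whenever $x,y\in T$. For a family $\mathcal{S}=\{S_i\}_{i\in I}$ of multiplicatively closed subsets of $R$, $\widetilde{V}(\mathcal{S})=\{P\in\operatorname{Spec}(M) \mid (P:M)\cap S_i\neq\emptyset \text{ for all } i\in I\}$. $\widetilde{\operatorname{Spec}(M)}$ denotes the set $\operatorname{Spec}(M)$ with the topology whose closed sets are exactly the sets $\widetilde{V}(\mathcal{S})$, $\mathcal{S}$ ranging over all families of multiplicatively closed subsets of $R$. A topological space $X$ is $T_1$ if for any distinct points $x,y\in X$ there is an open set $O$ with $x\in O$ and $y\notin O$; equivalently $\overline{\{x\}}=\{x\}$ for every $x\in X$.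
   Formalization: Incomparability is required of (Q:M), (Q':M) for all distinct Q, Q' in Spec(M), so Q ↦ (Q:M) must also be injective; read as a bare set the claim fails for M = k² over a field k, where every (Q:M) = 0 but the space is not T₁. *)

theory Defs
  imports "HOL-Algebra.Module" "HOL-Algebra.Ideal" "HOL-Analysis.T1_Spaces"
begin

definition colon :: "('a, 'c) ring_scheme \<Rightarrow> ('a, 'b, 'm) module_scheme \<Rightarrow> 'b set \<Rightarrow> 'a set" where
  "colon R M N = {r \<in> carrier R. \<forall>m \<in> carrier M. r \<odot>\<^bsub>M\<^esub> m \<in> N}"

definition prime_submodule :: "'b set \<Rightarrow> ('a, 'c) ring_scheme \<Rightarrow> ('a, 'b, 'm) module_scheme \<Rightarrow> bool" where
  "prime_submodule P R M \<longleftrightarrow>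
     submodule P R M \<and> P \<noteq> carrier M \<and>
     (\<forall>r \<in> carrier R. \<forall>m \<in> carrier M. r \<odot>\<^bsub>M\<^esub> m \<in> P \<longrightarrow> m \<in> P \<or> r \<in> colon R M P)"

definition Spec :: "('a, 'c) ring_scheme \<Rightarrow> ('a, 'b, 'm) module_scheme \<Rightarrow> 'b set set" where
  "Spec R M = {P. prime_submodule P R M}"

(* A multiplicatively closed subset of R containing 1 is a submonoid of (R, *, 1), i.e.
   "submonoid T R".  Only the range of a family (S_i) of such subsets matters for V~, so a family
   is represented by a set \<S> of subsets; the empty family is allowed. *)

definition mult_closed_family :: "('a, 'c) ring_scheme \<Rightarrow> 'a set set \<Rightarrow> bool" where
  "mult_closed_family R \<S> \<longleftrightarrow> (\<forall>T \<in> \<S>. submonoid T R)"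

definition V_tilde :: "('a, 'c) ring_scheme \<Rightarrow> ('a, 'b, 'm) module_scheme \<Rightarrow> 'a set set \<Rightarrow> 'b set set" where
  "V_tilde R M \<S> = {P \<in> Spec R M. \<forall>T \<in> \<S>. colon R M P \<inter> T \<noteq> {}}"

definition Spec_tilde :: "('a, 'c) ring_scheme \<Rightarrow> ('a, 'b, 'm) module_scheme \<Rightarrow> 'b set topology" where
  "Spec_tilde R M =
     topology (\<lambda>U. \<exists>\<S>. mult_closed_family R \<S> \<and> U = Spec R M - V_tilde R M \<S>)"

(* Incomparability is that of the family (J i), i in I: members with different indices are
   different members.  Forgetting the indices, i.e. looking only at the set J ` I, would lose
   information: for a vector space M over a field, Spec M consists of all proper subspaces Q and
   (Q:M) = 0 for each of them, so the set of all (Q:M) has a single member, whereas the topology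
   on Spec M is indiscrete, hence not T1 as soon as dim M >= 2. *)

definition incomparable_primes ::
  "('a, 'c) ring_scheme \<Rightarrow> 'i set \<Rightarrow> ('i \<Rightarrow> 'a set) \<Rightarrow> bool" where
  "incomparable_primes R I J \<longleftrightarrow>
     (\<forall>i \<in> I. primeideal (J i) R) \<and>
     (\<forall>i \<in> I. \<forall>j \<in> I. i \<noteq> j \<longrightarrow> \<not> J i \<subseteq> J j)"

lemma incomparable_primes_iff_image:
  "incomparable_primes R I J \<longleftrightarrow>
     inj_on J I \<and> (\<forall>A \<in> J ` I. primeideal A R) \<and>
     (\<forall>A \<in> J ` I. \<forall>B \<in> J ` I. A \<noteq> B \<longrightarrow> \<not> A \<subseteq> B)"
  unfolding incomparable_primes_def inj_on_def ball_simps by (intro iffI conjI ballI; metis order_refl)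

text \<open>The sets \<open>V_tilde R M \<S>\<close> are indeed the closed sets of a topology on \<open>Spec R M\<close>.\<close>

lemma (in Module.module) colon_inter_setmult:
  assumes P: "P \<in> Spec R M" and S: "submonoid S R" and T: "submonoid T R"
  shows "colon R M P \<inter> (S <#>\<^bsub>R\<^esub> T) \<noteq> {} \<longleftrightarrow> colon R M P \<inter> S \<noteq> {} \<or> colon R M P \<inter> T \<noteq> {}"
proof
  have prime: "m \<in> P \<or> r \<in> colon R M P"
    if "r \<in> carrier R" "m \<in> carrier M" "r \<odot>\<^bsub>M\<^esub> m \<in> P" for r m
    using P that unfolding Spec_def prime_submodule_def by blast
  assume "colon R M P \<inter> (S <#>\<^bsub>R\<^esub> T) \<noteq> {}"
  then obtain s t where st: "s \<in> S" "t \<in> T" "s \<otimes> t \<in> colon R M P"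
    unfolding set_mult_def by blast
  have c: "s \<in> carrier R" "t \<in> carrier R"
    using st S T submonoid.subset by blast+
  have "t \<in> colon R M P" if "s \<notin> colon R M P"
  proof -
    have "t \<odot>\<^bsub>M\<^esub> m \<in> P" if m: "m \<in> carrier M" for m
    proof -
      have "s \<odot>\<^bsub>M\<^esub> (t \<odot>\<^bsub>M\<^esub> m) \<in> P"
        using st(3) m c by (simp add: colon_def smult_assoc1)
      then show ?thesis
        using prime[OF c(1) smult_closed[OF c(2) m]] \<open>s \<notin> colon R M P\<close> by blast
    qed
    then show ?thesis using c by (simp add: colon_def)
  qed
  then show "colon R M P \<inter> S \<noteq> {} \<or> colon R M P \<inter> T \<noteq> {}"
    using st by blast
next
  have one: "\<one> \<in> S" "\<one> \<in> T"
    using S T submonoid.one_closed by blast+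
  have sub: "S \<subseteq> carrier R" "T \<subseteq> carrier R"
    using S T submonoid.subset by blast+
  have 1: "S \<subseteq> S <#>\<^bsub>R\<^esub> T"
  proof
    fix s assume "s \<in> S"
    then have "s \<otimes> \<one> \<in> S <#>\<^bsub>R\<^esub> T" using one unfolding set_mult_def by blast
    then show "s \<in> S <#>\<^bsub>R\<^esub> T" using \<open>s \<in> S\<close> sub by (simp add: subsetD)
  qed
  have 2: "T \<subseteq> S <#>\<^bsub>R\<^esub> T"
  proof
    fix t assume "t \<in> T"
    then have "\<one> \<otimes> t \<in> S <#>\<^bsub>R\<^esub> T" using one unfolding set_mult_def by blast
    then show "t \<in> S <#>\<^bsub>R\<^esub> T" using \<open>t \<in> T\<close> sub by (simp add: subsetD)
  qed
  assume "colon R M P \<inter> S \<noteq> {} \<or> colon R M P \<inter> T \<noteq> {}"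
  with 1 2 show "colon R M P \<inter> (S <#>\<^bsub>R\<^esub> T) \<noteq> {}" by blast
qed

lemma (in Module.module) submonoid_setmult:
  assumes S: "submonoid S R" and T: "submonoid T R"
  shows "submonoid (S <#>\<^bsub>R\<^esub> T) R"
proof
  note sub = submonoid.subset[OF S] submonoid.subset[OF T]
  show "S <#>\<^bsub>R\<^esub> T \<subseteq> carrier R"
    using sub by (auto simp: set_mult_def)
  show "\<one> \<in> S <#>\<^bsub>R\<^esub> T"
  proof -
    have "\<one> \<otimes> \<one> \<in> S <#>\<^bsub>R\<^esub> T"
      using submonoid.one_closed[OF S] submonoid.one_closed[OF T] unfolding set_mult_def by blast
    then show ?thesis by simp
  qed
  fix x y assume "x \<in> S <#>\<^bsub>R\<^esub> T" "y \<in> S <#>\<^bsub>R\<^esub> T"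
  then obtain a b c d where *: "a \<in> S" "b \<in> T" "c \<in> S" "d \<in> T" "x = a \<otimes> b" "y = c \<otimes> d"
    unfolding set_mult_def by blast
  then have "a \<in> carrier R" "b \<in> carrier R" "c \<in> carrier R" "d \<in> carrier R"
    using sub by auto
  then have "x \<otimes> y = (a \<otimes> c) \<otimes> (b \<otimes> d)"
    using * by (simp add: R.m_ac)
  moreover have "a \<otimes> c \<in> S" "b \<otimes> d \<in> T"
    using * submonoid.m_closed[OF S] submonoid.m_closed[OF T] by auto
  ultimately show "x \<otimes> y \<in> S <#>\<^bsub>R\<^esub> T"
    unfolding set_mult_def by blast
qed

lemma (in Module.module) istopology_Spec_tilde:
  "istopology (\<lambda>U. \<exists>\<S>. mult_closed_family R \<S> \<and> U = Spec R M - V_tilde R M \<S>)"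
  (is "istopology ?L")
  unfolding istopology_def
proof (intro conjI allI impI)
  fix U U' assume "?L U" "?L U'"
  then obtain A B where A: "mult_closed_family R A" "U = Spec R M - V_tilde R M A"
    and B: "mult_closed_family R B" "U' = Spec R M - V_tilde R M B" by blast
  define C where "C = (\<lambda>(S, T). S <#>\<^bsub>R\<^esub> T) ` (A \<times> B)"
  have "mult_closed_family R C"
    using A B submonoid_setmult by (auto simp: C_def mult_closed_family_def)
  moreover have "V_tilde R M C = V_tilde R M A \<union> V_tilde R M B"
  proof -
    have *: "(\<forall>T \<in> C. colon R M P \<inter> T \<noteq> {}) \<longleftrightarrow>
        (\<forall>S \<in> A. colon R M P \<inter> S \<noteq> {}) \<or> (\<forall>T \<in> B. colon R M P \<inter> T \<noteq> {})"
      if P: "P \<in> Spec R M" for P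
    proof -
      have "(\<forall>T \<in> C. colon R M P \<inter> T \<noteq> {}) \<longleftrightarrow>
          (\<forall>S \<in> A. \<forall>T \<in> B. colon R M P \<inter> (S <#>\<^bsub>R\<^esub> T) \<noteq> {})"
        unfolding C_def by blast
      also have "\<dots> \<longleftrightarrow>
          (\<forall>S \<in> A. \<forall>T \<in> B. colon R M P \<inter> S \<noteq> {} \<or> colon R M P \<inter> T \<noteq> {})"
        using A(1) B(1) unfolding mult_closed_family_def
        by (intro ball_cong refl colon_inter_setmult[OF P]) blast+
      also have "\<dots> \<longleftrightarrow>
          (\<forall>S \<in> A. colon R M P \<inter> S \<noteq> {}) \<or> (\<forall>T \<in> B. colon R M P \<inter> T \<noteq> {})"
        by (metis (no_types))
      finally show ?thesis .
    qed
    show ?thesis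
    proof (rule Set.set_eqI)
      fix P
      show "P \<in> V_tilde R M C \<longleftrightarrow> P \<in> V_tilde R M A \<union> V_tilde R M B"
        unfolding V_tilde_def Un_iff mem_Collect_eq using *[of P] by satx
    qed
  qed
  ultimately show "?L (U \<inter> U')"
    unfolding A(2) B(2) by (intro exI[of _ C]) blast
next
  fix \<K> assume "\<forall>K \<in> \<K>. ?L K"
  from bchoice[OF this] obtain f where
    "\<forall>K \<in> \<K>. mult_closed_family R (f K) \<and> K = Spec R M - V_tilde R M (f K)" ..
  then have f: "\<And>K. K \<in> \<K> \<Longrightarrow> mult_closed_family R (f K)"
    and K: "\<And>K. K \<in> \<K> \<Longrightarrow> Spec R M - V_tilde R M (f K) = K"
    by blast+
  (* the singleton {R} makes the empty union come out as the complement of V~({R}) = Spec M *)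
  define C where "C = insert (carrier R) (\<Union>(f ` \<K>))"
  have "submonoid (carrier R) R"
    by unfold_locales auto
  then have "mult_closed_family R C"
    using f by (auto simp: C_def mult_closed_family_def)
  moreover have "\<Union>\<K> = Spec R M - V_tilde R M C"
  proof -
    have "\<zero> \<in> colon R M P" if "P \<in> Spec R M" for P
      using that subgroup.one_closed[of P "add_monoid M"]
      by (auto simp: colon_def Spec_def prime_submodule_def submodule_def)
    then have z: "colon R M P \<inter> carrier R \<noteq> {}" if "P \<in> Spec R M" for P
      using that by blast
    have "\<Union>\<K> = (\<Union>K \<in> \<K>. Spec R M - V_tilde R M (f K))"
      by (simp add: K)
    also have "\<dots> = Spec R M - V_tilde R M C"
      using z unfolding C_def V_tilde_def by blast
    finally show ?thesis .
  qed
  ultimately show "?L (\<Union>\<K>)" by blast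
qed

lemma (in Module.module) openin_Spec_tilde_iff:
  "openin (Spec_tilde R M) U \<longleftrightarrow>
     (\<exists>\<S>. mult_closed_family R \<S> \<and> U = Spec R M - V_tilde R M \<S>)"
  unfolding Spec_tilde_def by (simp add: topology_inverse'[OF istopology_Spec_tilde])

lemma (in Module.module) topspace_Spec_tilde: "topspace (Spec_tilde R M) = Spec R M"
proof -
  have "submonoid {\<one>} R" by unfold_locales auto
  have "V_tilde R M {{\<one>}} = {}"
  proof -
    have "\<one> \<notin> colon R M P" if P: "P \<in> Spec R M" for P
    proof
      assume "\<one> \<in> colon R M P"
      then have "carrier M \<subseteq> P" by (auto simp: colon_def)
      moreover have "P \<subseteq> carrier M"
        using P subgroup.subset[of P "add_monoid M"]
        by (auto simp: Spec_def prime_submodule_def submodule_def)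
      ultimately show False
        using P by (auto simp: Spec_def prime_submodule_def)
    qed
    then show ?thesis by (auto simp: V_tilde_def)
  qed
  then have "openin (Spec_tilde R M) (Spec R M)"
    using \<open>submonoid {\<one>} R\<close> unfolding openin_Spec_tilde_iff mult_closed_family_def
    by (intro exI[of _ "{{\<one>}}"]) simp
  moreover have "U \<subseteq> Spec R M" if "openin (Spec_tilde R M) U" for U
    using that unfolding openin_Spec_tilde_iff by blast
  ultimately show ?thesis
    by (auto simp: topspace_def)
qed

lemma (in Module.module) closedin_Spec_tilde_iff:
  "closedin (Spec_tilde R M) C \<longleftrightarrow> (\<exists>\<S>. mult_closed_family R \<S> \<and> C = V_tilde R M \<S>)"
proof -
  have V: "V_tilde R M \<S> \<subseteq> Spec R M" for \<S> by (auto simp: V_tilde_def)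
  have "closedin (Spec_tilde R M) C \<longleftrightarrow>
      C \<subseteq> Spec R M \<and> (\<exists>\<S>. mult_closed_family R \<S> \<and> Spec R M - C = Spec R M - V_tilde R M \<S>)"
    unfolding closedin_def topspace_Spec_tilde openin_Spec_tilde_iff ..
  also have "\<dots> \<longleftrightarrow> (\<exists>\<S>. mult_closed_family R \<S> \<and> C = V_tilde R M \<S>)"
    using V by (metis double_diff subset_refl)
  finally show ?thesis .
qed

end

theory Submission
  imports Defs
begin

text \<open>The complement of a prime ideal is multiplicatively closed. Hence \<open>P\<close> has an open
  neighbourhood missing \<open>Q\<close> iff \<open>(Q:M)\<close> is not contained in \<open>(P:M)\<close>.\<close>

lemma (in Module.module) ideal_colon:
  assumes "submodule N R M"
  shows "ideal (colon R M N) R"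
proof (rule idealI[OF R.ring_axioms])
  interpret N: submodule N R M by fact
  \<comment> \<open>A submodule is a subgroup of \<open>add_monoid M\<close>, so its closure facts
    come in multiplicative notation and are restated additively.\<close>
  have zero: "\<zero>\<^bsub>M\<^esub> \<in> N" and add: "\<And>x y. x \<in> N \<Longrightarrow> y \<in> N \<Longrightarrow> x \<oplus>\<^bsub>M\<^esub> y \<in> N"
    using N.one_closed N.m_closed by simp_all
  have inv: "\<ominus>\<^bsub>M\<^esub> x \<in> N" if "x \<in> N" for x
    using N.m_inv_closed[OF that] by (simp add: a_inv_def)
  show "subgroup (colon R M N) (add_monoid R)"
  proof
    show "inv\<^bsub>add_monoid R\<^esub> x \<in> colon R M N" if "x \<in> colon R M N" for x
      using that inv by (simp add: colon_def smult_l_minus flip: a_inv_def)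
  qed (use zero add in \<open>auto simp: colon_def smult_l_distr\<close>)
  show "x \<otimes> a \<in> colon R M N" if "a \<in> colon R M N" "x \<in> carrier R" for a x
    using that N.smult_closed by (simp add: colon_def smult_assoc1)
  show "a \<otimes> x \<in> colon R M N" if "a \<in> colon R M N" "x \<in> carrier R" for a x
    using that by (simp add: colon_def smult_assoc1)
qed

text \<open>This settles the primality clause of \<open>incomparable_primes\<close> and lets
  complements of colon ideals serve as members of a family.\<close>

lemma (in Module.module) primeideal_colon:
  assumes P: "prime_submodule P R M"
  shows "primeideal (colon R M P) R"
proof (rule primeidealI[OF _ is_cring])
  have sub: "submodule P R M" and ne: "P \<noteq> carrier M"
    and prime: "\<And>r m. \<lbrakk>r \<in> carrier R; m \<in> carrier M; r \<odot>\<^bsub>M\<^esub> m \<in> P\<rbrakk>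
      \<Longrightarrow> m \<in> P \<or> r \<in> colon R M P"
    using P unfolding prime_submodule_def by blast+
  show "ideal (colon R M P) R" by (rule ideal_colon[OF sub])
  show "carrier R \<noteq> colon R M P"
  proof
    assume "carrier R = colon R M P"
    then have "\<one> \<in> colon R M P" by auto
    then have "carrier M \<subseteq> P" by (auto simp: colon_def)
    then show False
      using ne subgroup.subset[of P "add_monoid M"] sub by (auto simp: submodule_def)
  qed
  show "a \<in> colon R M P \<or> b \<in> colon R M P"
    if a: "a \<in> carrier R" and b: "b \<in> carrier R" and ab: "a \<otimes> b \<in> colon R M P" for a b
  proof -
    \<comment> \<open>Primality of \<open>P\<close> is applied to a(bm) = (ab)m in \<open>P\<close>.
      The alternative on a does not depend on m, so if it fails, bm lies in \<open>P\<close> for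
      every m.\<close>
    have "b \<odot>\<^bsub>M\<^esub> m \<in> P \<or> a \<in> colon R M P" if "m \<in> carrier M" for m
      using that a b ab by (intro prime) (simp_all add: colon_def smult_assoc1)
    then show ?thesis using b by (auto simp: colon_def)
  qed
qed

lemma (in primeideal) submonoid_compl: "submonoid (carrier R - I) R"
proof
  show "\<one> \<in> carrier R - I" using I_notcarr one_imp_carrier by auto
qed (use I_prime in auto)

lemma (in Module.module) separated_Spec_tilde_iff:
  assumes P: "P \<in> Spec R M" and Q: "Q \<in> Spec R M"
  shows "(\<exists>U. openin (Spec_tilde R M) U \<and> P \<in> U \<and> Q \<notin> U) \<longleftrightarrow>
    \<not> colon R M Q \<subseteq> colon R M P"
proof
  assume "\<exists>U. openin (Spec_tilde R M) U \<and> P \<in> U \<and> Q \<notin> U"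
  \<comment> \<open>Since \<open>P\<close> lies in \<open>U\<close>, some member T of the defining
    family misses (P:M). Since \<open>Q\<close> does not, (Q:M) meets T, and a common element lies
    outside (P:M).\<close>
  then show "\<not> colon R M Q \<subseteq> colon R M P"
    using P Q unfolding openin_Spec_tilde_iff V_tilde_def by blast
next
  assume nsub: "\<not> colon R M Q \<subseteq> colon R M P"
  \<comment> \<open>This is the largest subset of \<open>R\<close> that misses (P:M), so (Q:M) meets
    it exactly when (Q:M) is not contained in (P:M).\<close>
  define T where "T = carrier R - colon R M P"
  have "primeideal (colon R M P) R"
    using P by (simp add: Spec_def primeideal_colon)
  then have "mult_closed_family R {T}"
    by (simp add: mult_closed_family_def T_def primeideal.submonoid_compl)
  moreover have "colon R M Q \<inter> T \<noteq> {}" "colon R M P \<inter> T = {}"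
    using nsub unfolding T_def colon_def by blast+
  ultimately show "\<exists>U. openin (Spec_tilde R M) U \<and> P \<in> U \<and> Q \<notin> U"
    using P Q unfolding openin_Spec_tilde_iff
    by (intro exI[of _ "Spec R M - V_tilde R M {T}"]) (auto simp: V_tilde_def)
qed

theorem theorem9:
  fixes R :: "('a, 'c) ring_scheme" and M :: "('a, 'b, 'm) module_scheme"
  assumes "Module.module R M"
    and "Spec R M \<noteq> {}"
  shows "t1_space (Spec_tilde R M) \<longleftrightarrow> incomparable_primes R (Spec R M) (colon R M)"
proof -
  interpret Module.module R M by fact
  have "\<forall>P \<in> Spec R M. primeideal (colon R M P) R"
    by (simp add: Spec_def primeideal_colon)
  \<comment> \<open>Separation of \<open>P\<close> from \<open>Q\<close> reverses the inclusion,
    which is harmless because both conditions range over all ordered pairs of distinct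
    points.\<close>
  moreover have "t1_space (Spec_tilde R M) \<longleftrightarrow>
      (\<forall>P \<in> Spec R M. \<forall>Q \<in> Spec R M. P \<noteq> Q \<longrightarrow> \<not> colon R M Q \<subseteq> colon R M P)"
    unfolding t1_space_def topspace_Spec_tilde by (simp add: separated_Spec_tilde_iff)
  ultimately show ?thesis
    unfolding incomparable_primes_def by metis
qed

end
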